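(* Let $X,Y$ be compact metric spaces and let $\omega$ be a Radon measure on $X$. Let $N\ge2$, let $p_1,\dots,p_N$ be distinct points in $Y$, and let $g_1,\dots,g_N$ be positive numbers. Let $\mathcal F\subset C(X)$ and $\mathcal T:\mathcal F\to C_s(X,Y)$ be such that $\mathcal F$ is $\mathcal T$-convex and property (A3'') (defined in the context) holds, with functions $h_{t,y_0}$, $y_0\in Y$, $\alpha_{y_0}<t<\beta_{y_0}$. Assume that $$\omega(X)=\sum_{i=1}^N g_i,$$ and that there exist $b_i^0\in(\alpha_{p_i},\beta_{p_i})$, $1\le i\le N$, such that the function $\rho_0=\max_{1\le i\le N}h_{b_i^0,p_i}$ satisfies $M_{\mathcal T(\rho_0)}(\{p_i\})\le g_i$ for $2\le i\le N$. Then there exist $b_i\in(\alpha_{p_i},\beta_{p_i})$, $2\le i\le N$, such that, with $b_1=b_1^0$, the function $$\rho(x)=\max_{1\le i\le N}h_{b_i,p_i}(x)$$ satisfies $$M_{\mathcal T(\rho)}=\sum_{i=1}^N g_i\,\delta_{p_i}.$$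
   Context: Let $X,Y$ be compact metric spaces and $\omega$ a Radon measure on $X$ (nonnegative, finite, completed). A set-valued map $\Phi$ from $X$ to $Y$ assigns to each $x\in X$ a nonempty subset $\Phi(x)\subset Y$. $Y^X$ denotes the class of set-valued maps $\Phi$ from $X$ to $Y$ such that $\Phi(x)$ is a singleton for $\omega$-a.e. $x$. A map $\Phi\in Y^X$ is continuous at $x_0\in X$ if, whenever $x_k\to x_0$ and $y_k\in\Phi(x_k)$, there are a subsequence $y_{k_j}$ and $y_0\in\Phi(x_0)$ with $y_{k_j}\to y_0$. $C(X,Y)$ is the class of $\Phi\in Y^X$ continuous at every point of $X$, and $C_s(X,Y)$ is the class of $\Phi\in C(X,Y)$ with $\Phi(X)=\bigcup_{x\in X}\Phi(x)=Y$. For $\Phi\in C_s(X,Y)$ and $E\subset Y$, $\Phi^{-1}(E)=\{x\in X:\Phi(x)\cap E\ne\emptyset\}$, and $M_\Phi(E)=\omega(\Phi^{-1}(E))$, which is a Radon measure on $Y$. $C(X)$ is the set of real continuous functions on $X$ with the topology of uniform convergence. A map $\mathcal T:\mathcal F\to C_s(X,Y)$, $\mathcal F\subset C(X)$, is continuous at $\phi\in\mathcal F$ if whenever $\phi_j\in\mathcal F$, $\phi_j\to\phi$ uniformly in $X$, $x_0\in X$ and $y_j\in\mathcal T(\phi_j)(x_0)$, there is a subsequence $y_{j_\ell}$ converging to some $y_0\in\mathcal T(\phi)(x_0)$. A class $\mathcal F\subset C(X)$ is $\mathcal T$-convex if: (A1') $f_1,f_2\in\mathcal F$ implies $f_1\vee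 f_2=\max\{f_1,f_2\}\in\mathcal F$; and $\mathcal T:\mathcal F\to C_s(X,Y)$ is a map that is continuous at each $\phi\in\mathcal F$ and satisfies (A2'): if $\phi_1,\phi_2\in\mathcal F$ and $\phi_1(x_0)\ge\phi_2(x_0)$, then $\mathcal T(\phi_1)(x_0)\subset\mathcal T(\phi_1\vee\phi_2)(x_0)$. Property (A3''): for each $y_0\in Y$ there exist an interval $(\alpha_{y_0},\beta_{y_0})$ (endpoints possibly infinite) and a family $\{h_{t,y_0}\}_{\alpha_{y_0}<t<\beta_{y_0}}\subset\mathcal F$ such that (a) $y_0\in\mathcal T(h_{t,y_0})(x)$ for all $x\in X$; (b) $h_{t,y_0}\le h_{s,y_0}$ for $t\le s$; (c) $h_{t,y_0}\to+\infty$ uniformly as $t\to\beta_{y_0}$; (d) $\max_{x\in X}|h_{t',y_0}(x)-h_{t,y_0}(x)|\to 0$ as $t'\to t$, for $\alpha_{y_0}<t<\beta_{y_0}$. *)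

theory Defs
  imports "HOL-Probability.Giry_Monad"
begin

text \<open>
  The compact metric spaces are rendered as types of class \<^class>\<open>metric_space\<close> whose universe is
  assumed to be compact. A set-valued map from \<open>'a\<close> to \<open>'b\<close> is a function \<open>'a \<Rightarrow> 'b set\<close>
  with nonempty values.
\<close>

text \<open>
  Finite Radon measures, completed. Given inner regularity, the condition
  \<open>sets borel \<subseteq> sets \<omega>\<close> together with completeness forces \<open>sets \<omega>\<close> to be
  exactly the completion of the Borel sets, and \<open>space \<omega> = UNIV\<close>.
\<close>

definition radon_measure :: "'a::metric_space measure \<Rightarrow> bool" where
  "radon_measure \<omega> \<longleftrightarrow>
     finite_measure \<omega> \<and> complete_measure \<omega> \<and> sets borel \<subseteq> sets \<omega> \<and>
     (\<forall>E\<in>sets \<omega>. emeasure \<omega> E = (SUP K\<in>{K. compact K \<and> K \<subseteq> E}. emeasure \<omega> K))"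

definition set_maps :: "'a measure \<Rightarrow> ('a \<Rightarrow> 'b set) set" where
  "set_maps \<omega> = {\<Phi>. (\<forall>x. \<Phi> x \<noteq> {}) \<and> (AE x in \<omega>. is_singleton (\<Phi> x))}"

definition set_map_cont_at :: "('a::metric_space \<Rightarrow> 'b::metric_space set) \<Rightarrow> 'a \<Rightarrow> bool" where
  "set_map_cont_at \<Phi> x0 \<longleftrightarrow>
     (\<forall>x y. x \<longlonglongrightarrow> x0 \<and> (\<forall>k::nat. y k \<in> \<Phi> (x k)) \<longrightarrow>
        (\<exists>r y0. strict_mono (r :: nat \<Rightarrow> nat) \<and> y0 \<in> \<Phi> x0 \<and> (y \<circ> r) \<longlonglongrightarrow> y0))"

definition cont_set_maps :: "'a::metric_space measure \<Rightarrow> ('a \<Rightarrow> 'b::metric_space set) set" where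
  "cont_set_maps \<omega> = {\<Phi> \<in> set_maps \<omega>. \<forall>x. set_map_cont_at \<Phi> x}"

definition surj_cont_set_maps :: "'a::metric_space measure \<Rightarrow> ('a \<Rightarrow> 'b::metric_space set) set" where
  "surj_cont_set_maps \<omega> = {\<Phi> \<in> cont_set_maps \<omega>. (\<Union>x. \<Phi> x) = UNIV}"

definition set_map_vimage :: "('a \<Rightarrow> 'b set) \<Rightarrow> 'b set \<Rightarrow> 'a set" where
  "set_map_vimage \<Phi> E = {x. \<Phi> x \<inter> E \<noteq> {}}"

text \<open>
  The measure \<open>E \<mapsto> \<omega> (\<Phi>\<^sup>-\<^sup>1 E)\<close> on the Borel sets of \<open>'b\<close>. That this set function is
  a measure, so that \<^const>\<open>measure_of\<close> does not degenerate, is \<open>emeasure_set_map_measure\<close> below.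
\<close>

definition set_map_measure ::
    "'a::metric_space measure \<Rightarrow> ('a \<Rightarrow> 'b::metric_space set) \<Rightarrow> 'b measure" where
  "set_map_measure \<omega> \<Phi> =
     measure_of UNIV (sets borel) (\<lambda>E. emeasure \<omega> (set_map_vimage \<Phi> E))"

text \<open>The measure \<open>\<Sum>i\<in>I. g i \<cdot> \<delta>\<^bsub>p i\<^esub>\<close>; the Dirac measure at \<open>y\<close> is \<^term>\<open>return borel y\<close>.\<close>

definition dirac_sum :: "'i set \<Rightarrow> ('i \<Rightarrow> real) \<Rightarrow> ('i \<Rightarrow> 'b::metric_space) \<Rightarrow> 'b measure" where
  "dirac_sum I g p =
     measure_of UNIV (sets borel) (\<lambda>E. \<Sum>i\<in>I. ennreal (g i) * emeasure (return borel (p i)) E)"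

definition cont_functions :: "('a::metric_space \<Rightarrow> real) set" where
  "cont_functions = {f. continuous_on UNIV f}"

definition operator_cont_at ::
    "('a::metric_space \<Rightarrow> real) set \<Rightarrow> (('a \<Rightarrow> real) \<Rightarrow> 'a \<Rightarrow> 'b::metric_space set) \<Rightarrow>
     ('a \<Rightarrow> real) \<Rightarrow> bool" where
  "operator_cont_at \<F> \<T> \<phi> \<longleftrightarrow>
     (\<forall>\<phi>s x0 y. (\<forall>j::nat. \<phi>s j \<in> \<F>) \<and> uniform_limit UNIV \<phi>s \<phi> sequentially \<and>
        (\<forall>j. y j \<in> \<T> (\<phi>s j) x0) \<longrightarrow>
        (\<exists>r y0. strict_mono (r :: nat \<Rightarrow> nat) \<and> y0 \<in> \<T> \<phi> x0 \<and> (y \<circ> r) \<longlonglongrightarrow> y0))"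

definition T_convex ::
    "'a::metric_space measure \<Rightarrow> ('a \<Rightarrow> real) set \<Rightarrow>
     (('a \<Rightarrow> real) \<Rightarrow> 'a \<Rightarrow> 'b::metric_space set) \<Rightarrow> bool" where
  "T_convex \<omega> \<F> \<T> \<longleftrightarrow>
     \<F> \<subseteq> cont_functions \<and>
     \<T> \<in> \<F> \<rightarrow> surj_cont_set_maps \<omega> \<and>
     (\<forall>f1\<in>\<F>. \<forall>f2\<in>\<F>. (\<lambda>x. max (f1 x) (f2 x)) \<in> \<F>) \<and>
     (\<forall>\<phi>\<in>\<F>. operator_cont_at \<F> \<T> \<phi>) \<and>
     (\<forall>\<phi>1\<in>\<F>. \<forall>\<phi>2\<in>\<F>. \<forall>x0. \<phi>1 x0 \<ge> \<phi>2 x0 \<longrightarrow>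
        \<T> \<phi>1 x0 \<subseteq> \<T> (\<lambda>x. max (\<phi>1 x) (\<phi>2 x)) x0)"

definition open_interval :: "ereal \<Rightarrow> ereal \<Rightarrow> real set" where
  "open_interval a b = {t. a < ereal t \<and> ereal t < b}"

text \<open>
  For each \<open>y\<close> a family of functions indexed by an interval: the endpoints \<open>\<alpha>, \<beta>\<close> and the family \<open>h\<close> (\<open>h y t\<close> being
  \<open>h\<^bsub>t,y\<^esub>\<close>) are parameters. The values of \<open>h y t\<close> for \<open>t\<close> outside the interval are irrelevant.
  In the last clause the supremum is a maximum for \<open>t'\<close> close to \<open>t\<close>: the functions
  are continuous and \<open>'a\<close> is compact.
\<close>

definition exhausting_families ::
    "('a::metric_space \<Rightarrow> real) set \<Rightarrow> (('a \<Rightarrow> real) \<Rightarrow> 'a \<Rightarrow> 'b::metric_space set) \<Rightarrow>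
     ('b \<Rightarrow> ereal) \<Rightarrow> ('b \<Rightarrow> ereal) \<Rightarrow> ('b \<Rightarrow> real \<Rightarrow> 'a \<Rightarrow> real) \<Rightarrow> bool" where
  "exhausting_families \<F> \<T> \<alpha> \<beta> h \<longleftrightarrow>
     (\<forall>y. \<alpha> y < \<beta> y \<and>
        (\<forall>t\<in>open_interval (\<alpha> y) (\<beta> y). h y t \<in> \<F>) \<and>
        (\<forall>t\<in>open_interval (\<alpha> y) (\<beta> y). \<forall>x. y \<in> \<T> (h y t) x) \<and>
        (\<forall>t\<in>open_interval (\<alpha> y) (\<beta> y). \<forall>s\<in>open_interval (\<alpha> y) (\<beta> y).
           t \<le> s \<longrightarrow> (\<forall>x. h y t x \<le> h y s x)) \<and>
        (\<forall>K::real. \<exists>t0\<in>open_interval (\<alpha> y) (\<beta> y). \<forall>t\<in>open_interval (\<alpha> y) (\<beta> y).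
           t0 < t \<longrightarrow> (\<forall>x. K \<le> h y t x)) \<and>
        (\<forall>t\<in>open_interval (\<alpha> y) (\<beta> y).
           ((\<lambda>t'. SUP x. \<bar>h y t' x - h y t x\<bar>) \<longlongrightarrow> 0) (at t)))"

lemma sets_set_map_measure [simp]: "sets (set_map_measure \<omega> \<Phi>) = sets borel"
  unfolding set_map_measure_def by (simp add: sets.sigma_sets_eq[of borel, unfolded space_borel])

lemma sets_dirac_sum [simp]: "sets (dirac_sum I g p) = sets borel"
  unfolding dirac_sum_def by (simp add: sets.sigma_sets_eq[of borel, unfolded space_borel])

lemma closed_set_map_vimage:
  fixes \<Phi> :: "'a::metric_space \<Rightarrow> 'b::metric_space set"
  assumes "\<forall>x. set_map_cont_at \<Phi> x" "closed C"
  shows "closed (set_map_vimage \<Phi> C)"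
  unfolding closed_sequential_limits
proof (intro allI impI, elim conjE)
  fix x l assume x: "\<forall>n. x n \<in> set_map_vimage \<Phi> C" "x \<longlonglongrightarrow> l"
  then have "\<forall>n. \<exists>y. y \<in> \<Phi> (x n) \<and> y \<in> C"
    by (auto simp: set_map_vimage_def)
  then obtain y where y: "\<And>n. y n \<in> \<Phi> (x n)" "\<And>n. y n \<in> C"
    unfolding choice_iff by blast
  have "set_map_cont_at \<Phi> l" using assms(1) by blast
  with x(2) y(1) obtain r y0 where r: "y0 \<in> \<Phi> l" "(y \<circ> r) \<longlonglongrightarrow> y0"
    unfolding set_map_cont_at_def by blast
  have "y0 \<in> C" by (rule closed_sequentially[OF assms(2) _ r(2)]) (simp add: y(2))
  with r(1) show "l \<in> set_map_vimage \<Phi> C" unfolding set_map_vimage_def by blast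
qed

lemma not_singleton_null:
  assumes "radon_measure \<omega>" "\<Phi> \<in> set_maps \<omega>"
  shows "{x. \<not> is_singleton (\<Phi> x)} \<in> null_sets \<omega>"
proof -
  interpret complete_measure \<omega> using assms(1) by (simp add: radon_measure_def)
  have "UNIV \<in> sets \<omega>" using assms(1) by (auto simp: radon_measure_def)
  then have "space \<omega> = UNIV" using sets.sets_into_space by blast
  with assms(2) show ?thesis by (simp add: set_maps_def AE_iff_null_sets)
qed

lemma set_map_vimage_overlap_subset:
  assumes "A \<inter> B = {}"
  shows "set_map_vimage \<Phi> A \<inter> set_map_vimage \<Phi> B \<subseteq> {x. \<not> is_singleton (\<Phi> x)}"
proof (intro subsetI CollectI notI)
  fix x assume x: "x \<in> set_map_vimage \<Phi> A \<inter> set_map_vimage \<Phi> B" and "is_singleton (\<Phi> x)"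
  then obtain y where "\<Phi> x = {y}" by (auto elim: is_singletonE)
  with x have "y \<in> A" "y \<in> B" by (simp_all add: set_map_vimage_def)
  with assms show False by blast
qed

lemma set_map_vimage_overlap_null:
  assumes "radon_measure \<omega>" "\<Phi> \<in> set_maps \<omega>" "A \<inter> B = {}"
  shows "set_map_vimage \<Phi> A \<inter> set_map_vimage \<Phi> B \<in> null_sets \<omega>"
proof -
  interpret complete_measure \<omega> using assms(1) by (simp add: radon_measure_def)
  show ?thesis
    by (rule complete2[OF set_map_vimage_overlap_subset[OF assms(3)] not_singleton_null[OF assms(1,2)]])
qed

lemma sets_set_map_vimage:
  fixes \<Phi> :: "'a::metric_space \<Rightarrow> 'b::metric_space set"
  assumes "radon_measure \<omega>" "\<Phi> \<in> cont_set_maps \<omega>" "E \<in> sets borel"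
  shows "set_map_vimage \<Phi> E \<in> sets \<omega>"
proof -
  have borel: "B \<in> sets \<omega>" if "B \<in> sets borel" for B
    using assms(1) that by (auto simp: radon_measure_def)
  have \<Phi>: "\<Phi> \<in> set_maps \<omega>" and cont: "\<forall>x. set_map_cont_at \<Phi> x"
    using assms(2) by (auto simp: cont_set_maps_def)
  have ne: "\<Phi> x \<noteq> {}" for x using \<Phi> by (simp add: set_maps_def)
  have "E \<in> sigma_sets UNIV (Collect closed)"
    using assms(3) by (simp add: borel_eq_closed)
  then show ?thesis
  proof induction
    case (Basic C)
    then show ?case using closed_set_map_vimage[OF cont] by (intro borel) auto
  next
    case Empty
    then show ?case by (simp add: set_map_vimage_def)
  next
    case (Compl C)
    have eq: "set_map_vimage \<Phi> (UNIV - C) =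
        (UNIV - set_map_vimage \<Phi> C) \<union> (set_map_vimage \<Phi> (UNIV - C) \<inter> set_map_vimage \<Phi> C)"
      using ne by (auto simp: set_map_vimage_def)
    have 1: "UNIV - set_map_vimage \<Phi> C \<in> sets \<omega>"
      using Compl.IH borel[of UNIV] by (intro sets.Diff) auto
    have 2: "set_map_vimage \<Phi> (UNIV - C) \<inter> set_map_vimage \<Phi> C \<in> sets \<omega>"
      using set_map_vimage_overlap_null[OF assms(1) \<Phi>, of "UNIV - C" C] by auto
    show ?case by (subst eq) (rule sets.Un[OF 1 2])
  next
    case (Union A)
    have "set_map_vimage \<Phi> (\<Union>i. A i) = (\<Union>i. set_map_vimage \<Phi> (A i))"
      by (auto simp: set_map_vimage_def)
    then show ?case using Union.IH by auto
  qed
qed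

lemma emeasure_set_map_measure:
  fixes \<Phi> :: "'a::metric_space \<Rightarrow> 'b::metric_space set"
  assumes "radon_measure \<omega>" "\<Phi> \<in> cont_set_maps \<omega>" "E \<in> sets borel"
  shows "emeasure (set_map_measure \<omega> \<Phi>) E = emeasure \<omega> (set_map_vimage \<Phi> E)"
proof (rule emeasure_measure_of[OF set_map_measure_def[of \<omega> \<Phi>]])
  have \<Phi>: "\<Phi> \<in> set_maps \<omega>" using assms(2) by (auto simp: cont_set_maps_def)
  show "positive (sets (set_map_measure \<omega> \<Phi>)) (\<lambda>E. emeasure \<omega> (set_map_vimage \<Phi> E))"
    by (simp add: positive_def set_map_vimage_def)
  show "countably_additive (sets (set_map_measure \<omega> \<Phi>)) (\<lambda>E. emeasure \<omega> (set_map_vimage \<Phi> E))"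
  proof (rule countably_additiveI)
    fix A :: "nat \<Rightarrow> 'b set"
    assume A: "range A \<subseteq> sets (set_map_measure \<omega> \<Phi>)" "disjoint_family A"
    have m: "set_map_vimage \<Phi> (A i) \<in> sets \<omega>" for i
      using A(1) by (intro sets_set_map_vimage[OF assms(1,2)]) auto
    have u: "set_map_vimage \<Phi> (\<Union>i. A i) = (\<Union>i. set_map_vimage \<Phi> (A i))"
      by (auto simp: set_map_vimage_def)
    let ?B = "\<lambda>i. set_map_vimage \<Phi> (A i) - {x. \<not> is_singleton (\<Phi> x)}"
    have null: "{x. \<not> is_singleton (\<Phi> x)} \<in> null_sets \<omega>"
      by (rule not_singleton_null[OF assms(1) \<Phi>])
    have "disjoint_family ?B"
      unfolding disjoint_family_on_def
    proof (intro ballI impI)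
      fix i j :: nat assume "i \<noteq> j"
      with A(2) have "A i \<inter> A j = {}" by (simp add: disjoint_family_on_def)
      then show "?B i \<inter> ?B j = {}"
        using set_map_vimage_overlap_subset[of "A i" "A j" \<Phi>] by blast
    qed
    moreover have "?B i \<in> sets \<omega>" for i using m null by auto
    ultimately have "(\<Sum>i. emeasure \<omega> (?B i)) = emeasure \<omega> (\<Union>i. ?B i)"
      by (intro suminf_emeasure) auto
    also have "(\<Union>i. ?B i) = (\<Union>i. set_map_vimage \<Phi> (A i)) - {x. \<not> is_singleton (\<Phi> x)}"
      by auto
    finally have "(\<Sum>i. emeasure \<omega> (set_map_vimage \<Phi> (A i))) = emeasure \<omega> (\<Union>i. set_map_vimage \<Phi> (A i))"
      using m null by (simp add: emeasure_Diff_null_set sets.countable_UN)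
    then show "(\<Sum>i. emeasure \<omega> (set_map_vimage \<Phi> (A i))) = emeasure \<omega> (set_map_vimage \<Phi> (\<Union>(range A)))"
      by (simp add: u)
  qed
  show "E \<in> sets (set_map_measure \<omega> \<Phi>)" using assms(3) by simp
qed simp

lemma emeasure_dirac_sum:
  fixes p :: "'i \<Rightarrow> 'b::metric_space"
  assumes "finite I" "E \<in> sets borel"
  shows "emeasure (dirac_sum I g p) E = (\<Sum>i\<in>I. ennreal (g i) * indicator E (p i))"
proof -
  have "emeasure (dirac_sum I g p) E = (\<Sum>i\<in>I. ennreal (g i) * emeasure (return borel (p i)) E)"
  proof (rule emeasure_measure_of[OF dirac_sum_def[of I g p]])
    show "positive (sets (dirac_sum I g p)) (\<lambda>E. \<Sum>i\<in>I. ennreal (g i) * emeasure (return borel (p i)) E)"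
      by (simp add: positive_def)
    show "countably_additive (sets (dirac_sum I g p)) (\<lambda>E. \<Sum>i\<in>I. ennreal (g i) * emeasure (return borel (p i)) E)"
    proof (rule countably_additiveI)
      fix A :: "nat \<Rightarrow> 'b set"
      assume A: "range A \<subseteq> sets (dirac_sum I g p)" "disjoint_family A"
      have *: "(\<Sum>n. emeasure (return borel (p i)) (A n)) = emeasure (return borel (p i)) (\<Union>(range A))" for i
        using A by (intro suminf_emeasure) auto
      show "(\<Sum>n. \<Sum>i\<in>I. ennreal (g i) * emeasure (return borel (p i)) (A n)) =
          (\<Sum>i\<in>I. ennreal (g i) * emeasure (return borel (p i)) (\<Union>(range A)))"
        by (subst suminf_sum) (simp_all add: * del: emeasure_return)
    qed
    show "E \<in> sets (dirac_sum I g p)" using assms(2) by simp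
  qed simp
  then show ?thesis using assms(2) by (simp add: emeasure_return)
qed

end

theory Submission imports Defs begin

text \<open>
  Write \<open>E\<^sub>b\<close> for the maximum of the functions \<open>h (p i) (b i)\<close> and \<open>m\<^sub>i(b)\<close> for the \<open>\<omega>\<close>-measure of
  the set of all \<open>x\<close> with \<open>p i \<in> \<T> E\<^sub>b x\<close>. Where \<open>h (p i) (b i)\<close> attains the maximum,
  \<open>\<T>\<close>-convexity puts \<open>p i\<close> into \<open>\<T> E\<^sub>b x\<close>. Some index always attains it and \<open>\<T> E\<^sub>b x\<close> is almost everywhere a
  singleton, so almost everywhere \<open>\<T> E\<^sub>b x = {p i}\<close> for an attaining \<open>i\<close>. Hence the
  push-forward of \<open>\<omega>\<close> is always \<open>\<Sum>i. m\<^sub>i(b) \<delta>\<^bsub>p i\<^esub>\<close> with \<open>\<Sum>i. m\<^sub>i(b) = \<omega> UNIV\<close>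
  (\<open>set_map_measure_envelope\<close>, \<open>sum_mass\<close>), and the task is to choose \<open>b\<close>
  such that \<open>m\<^sub>i(b) = g i\<close> for all \<open>i\<close>.

  The choice is variational. Fix the parameter of the base index and let \<open>W\<close> be the set of all
  \<open>b \<ge> b0\<close> such that \<open>m\<^sub>i(b) \<le> g i\<close> at the other indices. On \<open>W\<close> the base index
  has mass at least its positive target. If some parameter came too close to the right end of its
  interval, its function would exceed the base function everywhere, and the base mass would vanish
  (\<open>mass_eq_0_if_dominated\<close>). So \<open>W\<close> lies in a compact box, and it is closed because
  the masses are continuous in \<open>b\<close> (\<open>mass_tendsto\<close>). Take \<open>b \<in> W\<close> with the largest sum of
  parameters. If \<open>m\<^sub>j(b) < g j\<close> for some \<open>j\<close> other than the base, then raising \<open>b j\<close> slightly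
  keeps this inequality by continuity and can only lower the other masses
  (\<open>mass_antimono_others\<close>), so the result is still in \<open>W\<close> and has a larger sum, a
  contradiction. The base mass is then correct because the totals agree.
\<close>

section \<open>Envelopes of finitely many members\<close>

locale finite_envelope =
  fixes \<omega> :: "'a::metric_space measure"
    and \<F> :: "('a \<Rightarrow> real) set"
    and \<T> :: "('a \<Rightarrow> real) \<Rightarrow> 'a \<Rightarrow> 'b::metric_space set"
    and \<alpha> \<beta> :: "'b \<Rightarrow> ereal"
    and h :: "'b \<Rightarrow> real \<Rightarrow> 'a \<Rightarrow> real"
    and I :: "'i::countable set"
    and p :: "'i \<Rightarrow> 'b"
  assumes compact_X: "compact (UNIV :: 'a set)"
    and radon: "radon_measure \<omega>"
    and convex: "T_convex \<omega> \<F> \<T>"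
    and exhausting: "exhausting_families \<F> \<T> \<alpha> \<beta> h"
    and finite_I [simp]: "finite I"
    and I_nonempty [simp]: "I \<noteq> {}"
    and inj_p: "inj_on p I"
begin

definition envelope :: "('i \<Rightarrow> real) \<Rightarrow> 'a \<Rightarrow> real" where
  "envelope b x = (MAX i\<in>I. h (p i) (b i) x)"

definition admissible :: "('i \<Rightarrow> real) set" where
  "admissible = {b. \<forall>i\<in>I. b i \<in> open_interval (\<alpha> (p i)) (\<beta> (p i))}"

definition cell :: "('i \<Rightarrow> real) \<Rightarrow> 'i \<Rightarrow> 'a set" where
  "cell b i = {x. p i \<in> \<T> (envelope b) x}"

definition multivalued :: "('i \<Rightarrow> real) \<Rightarrow> 'a set" where
  "multivalued b = {x. \<not> is_singleton (\<T> (envelope b) x)}"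

definition mass :: "('i \<Rightarrow> real) \<Rightarrow> 'i \<Rightarrow> real" where
  "mass b i = measure \<omega> (cell b i)"

sublocale complete_measure \<omega>
  using radon by (simp add: radon_measure_def)

sublocale finite_measure \<omega>
  using radon by (simp add: radon_measure_def)

lemma UNIV_sets [simp]: "UNIV \<in> sets \<omega>"
  using radon by (auto simp: radon_measure_def)

lemma admissibleD: "b \<in> admissible \<Longrightarrow> i \<in> I \<Longrightarrow> b i \<in> open_interval (\<alpha> (p i)) (\<beta> (p i))"
  by (simp add: admissible_def)

lemma
  assumes "t \<in> open_interval (\<alpha> y) (\<beta> y)"
  shows member_in_\<F>: "h y t \<in> \<F>"
    and member_contains: "y \<in> \<T> (h y t) x"
    and member_mono: "s \<in> open_interval (\<alpha> y) (\<beta> y) \<Longrightarrow> t \<le> s \<Longrightarrow> h y t x \<le> h y s x"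
    and member_cont: "((\<lambda>t'. SUP x. \<bar>h y t' x - h y t x\<bar>) \<longlongrightarrow> 0) (at t)"
  using exhausting assms unfolding exhausting_families_def by blast+

lemma member_unbounded:
  obtains t0 where "t0 \<in> open_interval (\<alpha> y) (\<beta> y)"
    and "\<And>t x. t \<in> open_interval (\<alpha> y) (\<beta> y) \<Longrightarrow> t0 < t \<Longrightarrow> K \<le> h y t x"
proof -
  have "\<exists>t0\<in>open_interval (\<alpha> y) (\<beta> y). \<forall>t\<in>open_interval (\<alpha> y) (\<beta> y).
          t0 < t \<longrightarrow> (\<forall>x. K \<le> h y t x)"
    using exhausting unfolding exhausting_families_def by blast
  then show ?thesis using that by blast
qed

lemma bounded_\<F>:
  assumes "f \<in> \<F>"
  obtains B where "\<And>x. \<bar>f x\<bar> \<le> B"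
proof -
  have "continuous_on UNIV f"
    using convex assms by (auto simp: T_convex_def cont_functions_def)
  then have "bounded (range f)"
    using compact_X by (intro compact_imp_bounded compact_continuous_image)
  then show ?thesis using that by (auto simp: bounded_iff)
qed

text \<open>The class is closed under binary maxima only, hence the induction over the index set.\<close>

lemma envelope_in_\<F>:
  assumes "b \<in> admissible"
  shows "envelope b \<in> \<F>"
proof -
  have "(\<lambda>x. MAX i\<in>J. h (p i) (b i) x) \<in> \<F>" if "finite J" "J \<noteq> {}" "J \<subseteq> I" for J
    using that
  proof (induction J rule: finite_ne_induct)
    case (singleton i)
    then show ?case using member_in_\<F>[OF admissibleD[OF assms, of i]] by simp
  next
    case (insert i J)
    have "h (p i) (b i) \<in> \<F>"
      using insert.prems member_in_\<F>[OF admissibleD[OF assms, of i]] by simp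
    moreover have "(\<lambda>x. MAX i\<in>J. h (p i) (b i) x) \<in> \<F>" using insert by simp
    ultimately have "(\<lambda>x. max (h (p i) (b i) x) (MAX i\<in>J. h (p i) (b i) x)) \<in> \<F>"
      using convex by (simp add: T_convex_def)
    then show ?case using insert.hyps by simp
  qed
  from this[of I] show ?thesis by (simp add: envelope_def[abs_def])
qed

lemma envelope_map:
  assumes "b \<in> admissible"
  shows "\<T> (envelope b) \<in> cont_set_maps \<omega>" "\<T> (envelope b) \<in> set_maps \<omega>"
  using envelope_in_\<F>[OF assms] convex
  by (auto simp: T_convex_def surj_cont_set_maps_def cont_set_maps_def)

lemma le_envelope: "i \<in> I \<Longrightarrow> h (p i) (b i) x \<le> envelope b x"
  by (simp add: envelope_def)

lemma envelope_attained:
  obtains i where "i \<in> I" "h (p i) (b i) x = envelope b x"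
proof -
  have "envelope b x \<in> (\<lambda>i. h (p i) (b i) x) ` I"
    unfolding envelope_def by (rule Max_in) auto
  then show ?thesis using that by auto
qed

lemma envelope_mono:
  assumes "b \<in> admissible" "b' \<in> admissible" "\<And>i. i \<in> I \<Longrightarrow> b i \<le> b' i"
  shows "envelope b x \<le> envelope b' x"
proof -
  obtain i where i: "i \<in> I" "h (p i) (b i) x = envelope b x" by (rule envelope_attained)
  have "h (p i) (b i) x \<le> h (p i) (b' i) x"
    using assms i(1) by (intro member_mono admissibleD)
  also have "\<dots> \<le> envelope b' x" using i(1) by (rule le_envelope)
  finally show ?thesis using i(2) by simp
qed

text \<open>
  The map of \<open>h (p i) (b i)\<close> takes the value \<open>p i\<close> everywhere. \<open>\<T>\<close>-convexity carries this value
  over to the maximum of that function with the envelope, which is the envelope itself.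
\<close>

lemma in_cell_if_attains:
  assumes "b \<in> admissible" "i \<in> I" "h (p i) (b i) x = envelope b x"
  shows "x \<in> cell b i"
proof -
  have mem: "h (p i) (b i) \<in> \<F>" using assms by (intro member_in_\<F> admissibleD)
  have "p i \<in> \<T> (h (p i) (b i)) x" using assms by (intro member_contains admissibleD)
  also have "\<T> (h (p i) (b i)) x \<subseteq> \<T> (\<lambda>z. max (h (p i) (b i) z) (envelope b z)) x"
    using convex mem envelope_in_\<F>[OF assms(1)] assms(3) by (simp add: T_convex_def)
  also have "(\<lambda>z. max (h (p i) (b i) z) (envelope b z)) = envelope b"
    using le_envelope[OF assms(2)] by (auto simp: max_def intro: antisym)
  finally show ?thesis by (simp add: cell_def)
qed

lemma envelope_value_off_multivalued:
  assumes "b \<in> admissible" "x \<notin> multivalued b"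
  obtains i where "i \<in> I" "\<T> (envelope b) x = {p i}" "h (p i) (b i) x = envelope b x"
proof -
  obtain i where i: "i \<in> I" "h (p i) (b i) x = envelope b x" by (rule envelope_attained)
  then have "p i \<in> \<T> (envelope b) x"
    using in_cell_if_attains[OF assms(1)] by (simp add: cell_def)
  moreover have "is_singleton (\<T> (envelope b) x)" using assms(2) by (simp add: multivalued_def)
  ultimately have "\<T> (envelope b) x = {p i}" by (auto elim!: is_singletonE)
  with i show ?thesis using that by blast
qed

lemma attains_if_in_cell:
  assumes "b \<in> admissible" "x \<notin> multivalued b" "i \<in> I" "x \<in> cell b i"
  shows "h (p i) (b i) x = envelope b x"
proof -
  obtain j where "j \<in> I" "\<T> (envelope b) x = {p j}" "h (p j) (b j) x = envelope b x"
    using assms(1,2) by (rule envelope_value_off_multivalued)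
  moreover from this assms have "i = j"
    using inj_onD[OF inj_p, of i j] by (simp add: cell_def)
  ultimately show ?thesis by simp
qed

section \<open>The push-forward measure of an envelope\<close>

lemma multivalued_null: "b \<in> admissible \<Longrightarrow> multivalued b \<in> null_sets \<omega>"
  unfolding multivalued_def using radon envelope_map(2) by (rule not_singleton_null)

lemma cell_eq_vimage: "cell b i = set_map_vimage (\<T> (envelope b)) {p i}"
  by (auto simp: cell_def set_map_vimage_def)

lemma cell_sets [measurable]: "b \<in> admissible \<Longrightarrow> cell b i \<in> sets \<omega>"
  unfolding cell_eq_vimage by (rule sets_set_map_vimage[OF radon envelope_map(1)]) auto

lemma mass_eq_set_map_measure:
  assumes "b \<in> admissible"
  shows "mass b i = measure (set_map_measure \<omega> (\<T> (envelope b))) {p i}"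
  using emeasure_set_map_measure[OF radon envelope_map(1)[OF assms], of "{p i}"]
  by (simp add: mass_def cell_eq_vimage measure_def)

lemma mass_diff_multivalued:
  assumes "b \<in> admissible"
  shows "measure \<omega> (cell b i - multivalued b) = mass b i"
  unfolding mass_def by (rule measure_Diff_null_set[OF cell_sets[OF assms] multivalued_null[OF assms]])

text \<open>
  Off the null set of multivalued points, \<open>\<T> (envelope b)\<close> takes only the values \<open>{p i}\<close>, and
  the cells are disjoint there because the points \<open>p i\<close> are distinct.
\<close>

lemma set_map_measure_envelope:
  assumes b: "b \<in> admissible"
  shows "set_map_measure \<omega> (\<T> (envelope b)) = dirac_sum I (mass b) p"
proof (rule measure_eqI)
  fix E assume "E \<in> sets (set_map_measure \<omega> (\<T> (envelope b)))"
  then have E: "E \<in> sets borel" by simp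
  let ?V = "set_map_vimage (\<T> (envelope b)) E"
  let ?J = "{i \<in> I. p i \<in> E}"
  let ?C = "\<lambda>i. cell b i - multivalued b"
  have V: "?V \<in> sets \<omega>" using radon envelope_map(1)[OF b] E by (rule sets_set_map_vimage)
  have "?V - multivalued b = (\<Union>i\<in>?J. ?C i)"
  proof (intro equalityI subsetI)
    fix x assume x: "x \<in> ?V - multivalued b"
    then obtain i where "i \<in> I" "\<T> (envelope b) x = {p i}"
      using envelope_value_off_multivalued[OF b, of x] by blast
    with x show "x \<in> (\<Union>i\<in>?J. ?C i)" by (auto simp: set_map_vimage_def cell_def)
  qed (auto simp: set_map_vimage_def cell_def)
  moreover have "disjoint_family_on ?C ?J"
    unfolding disjoint_family_on_def
  proof (intro ballI impI)
    fix i j assume ij: "i \<in> ?J" "j \<in> ?J" "i \<noteq> j"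
    have "x \<notin> ?C j" if x: "x \<in> ?C i" for x
    proof -
      obtain k where "k \<in> I" "\<T> (envelope b) x = {p k}"
        using envelope_value_off_multivalued[OF b, of x] x by blast
      with x ij show ?thesis using inj_onD[OF inj_p, of i j] by (auto simp: cell_def)
    qed
    then show "?C i \<inter> ?C j = {}" by blast
  qed
  ultimately have "emeasure \<omega> (?V - multivalued b) = (\<Sum>i\<in>?J. emeasure \<omega> (?C i))"
    using b multivalued_null[OF b] by (subst sum_emeasure) auto
  also have "\<dots> = (\<Sum>i\<in>?J. ennreal (mass b i))"
    using b by (simp add: emeasure_eq_measure mass_diff_multivalued)
  also have "\<dots> = (\<Sum>i\<in>I. if p i \<in> E then ennreal (mass b i) else 0)"
    using finite_I by (rule sum.inter_filter)
  also have "\<dots> = (\<Sum>i\<in>I. ennreal (mass b i) * indicator E (p i))"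
    by (intro sum.cong) (auto simp: indicator_def)
  finally show "emeasure (set_map_measure \<omega> (\<T> (envelope b))) E = emeasure (dirac_sum I (mass b) p) E"
    using b E V
    by (simp add: emeasure_set_map_measure[OF radon envelope_map(1)] emeasure_dirac_sum
          emeasure_Diff_null_set multivalued_null)
qed simp

lemma sum_mass:
  assumes b: "b \<in> admissible"
  shows "(\<Sum>i\<in>I. mass b i) = measure \<omega> UNIV"
proof -
  have "set_map_vimage (\<T> (envelope b)) UNIV = UNIV"
    using envelope_map(2)[OF b] by (simp add: set_maps_def set_map_vimage_def)
  then have "emeasure \<omega> UNIV = emeasure (dirac_sum I (mass b) p) UNIV"
    using emeasure_set_map_measure[OF radon envelope_map(1)[OF b], of UNIV]
    by (simp add: set_map_measure_envelope[OF b])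
  also have "\<dots> = ennreal (\<Sum>i\<in>I. mass b i)"
    by (simp add: emeasure_dirac_sum sum_ennreal mass_def)
  finally show ?thesis by (simp add: emeasure_eq_measure sum_nonneg mass_def)
qed

section \<open>Monotonicity and continuity of the masses\<close>

text \<open>
  Raising parameters other than the \<open>j\<close>-th raises the envelope and leaves the \<open>j\<close>-th function
  alone, so a point where that function attains the higher envelope is also one where it attains
  the lower one. Almost everywhere, these points make up the cells.
\<close>

lemma mass_antimono_others:
  assumes b: "b \<in> admissible" and b': "b' \<in> admissible"
    and le: "\<And>i. i \<in> I \<Longrightarrow> b i \<le> b' i" and j: "j \<in> I" "b j = b' j"
  shows "mass b' j \<le> mass b j"
proof -
  have "cell b' j - multivalued b' \<subseteq> cell b j"
  proof
    fix x assume x: "x \<in> cell b' j - multivalued b'"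
    have "envelope b x \<le> envelope b' x" using b b' le by (rule envelope_mono)
    also have "\<dots> = h (p j) (b j) x"
      using attains_if_in_cell[OF b' _ j(1), of x] x j(2) by simp
    finally have "h (p j) (b j) x = envelope b x"
      using le_envelope[OF j(1), of b x] by simp
    then show "x \<in> cell b j" using b j(1) by (intro in_cell_if_attains)
  qed
  then have "measure \<omega> (cell b' j - multivalued b') \<le> measure \<omega> (cell b j)"
    using b by (intro finite_measure_mono) auto
  then show ?thesis
    unfolding mass_diff_multivalued[OF b'] by (simp add: mass_def)
qed

lemma mass_eq_0_if_dominated:
  assumes b: "b \<in> admissible" and ij: "i \<in> I" "j \<in> I"
    and less: "\<And>x. h (p j) (b j) x < h (p i) (b i) x"
  shows "mass b j = 0"
proof -
  have "cell b j - multivalued b = {}"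
  proof -
    have False if "x \<in> cell b j - multivalued b" for x
      using attains_if_in_cell[OF b _ ij(2), of x] that less[of x] le_envelope[OF ij(1), of b x]
      by simp
    then show ?thesis by blast
  qed
  then show ?thesis unfolding mass_diff_multivalued[OF b, of j, symmetric] by (simp only: measure_empty)
qed

text \<open>
  The supremum in the hypothesis on \<open>h\<close> bounds the pointwise differences only because it is taken
  over a bounded set, which is where compactness of the domain enters.
\<close>

lemma member_uniform_limit:
  assumes t: "t \<in> open_interval (\<alpha> y) (\<beta> y)"
    and ts: "\<And>k::nat. ts k \<in> open_interval (\<alpha> y) (\<beta> y)" "ts \<longlonglongrightarrow> t"
  shows "uniform_limit UNIV (\<lambda>k. h y (ts k)) (h y t) sequentially"
  unfolding uniform_limit_iff
proof (intro allI impI)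
  fix e :: real assume e: "e > 0"
  let ?D = "\<lambda>t'. SUP x. \<bar>h y t' x - h y t x\<bar>"
  have "(?D \<longlongrightarrow> ?D t) (at t)" using member_cont[OF t] by simp
  then have "isCont ?D t" by (simp add: isCont_def)
  then have "(\<lambda>k. ?D (ts k)) \<longlonglongrightarrow> ?D t" using ts(2) by (rule isCont_tendsto_compose)
  then have "\<forall>\<^sub>F k in sequentially. ?D (ts k) < e" using e by (intro order_tendstoD) auto
  then show "\<forall>\<^sub>F k in sequentially. \<forall>x\<in>UNIV. dist (h y (ts k) x) (h y t x) < e"
  proof eventually_elim
    case (elim k)
    obtain B where B: "\<And>x. \<bar>h y (ts k) x\<bar> \<le> B" using member_in_\<F>[OF ts(1)] bounded_\<F> by blast
    obtain B' where B': "\<And>x. \<bar>h y t x\<bar> \<le> B'" using member_in_\<F>[OF t] bounded_\<F> by blast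
    have bdd: "bdd_above (range (\<lambda>x. \<bar>h y (ts k) x - h y t x\<bar>))"
    proof (rule bdd_aboveI2)
      fix x show "\<bar>h y (ts k) x - h y t x\<bar> \<le> B + B'" using B[of x] B'[of x] by linarith
    qed
    have "\<bar>h y (ts k) x - h y t x\<bar> < e" for x
      using cSUP_upper[OF UNIV_I bdd, of x] elim by linarith
    then show ?case by (simp add: dist_real_def)
  qed
qed

lemma envelope_uniform_limit:
  assumes b: "b \<in> admissible" and bs: "\<And>k. bs k \<in> admissible"
    and lim: "\<And>i. i \<in> I \<Longrightarrow> (\<lambda>k. bs k i) \<longlonglongrightarrow> b i"
  shows "uniform_limit UNIV (\<lambda>k. envelope (bs k)) (envelope b) sequentially"
  unfolding uniform_limit_iff
proof (intro allI impI)
  fix e :: real assume e: "e > 0"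
  have "\<forall>\<^sub>F k in sequentially. \<forall>i\<in>I. \<forall>x\<in>UNIV. dist (h (p i) (bs k i) x) (h (p i) (b i) x) < e"
  proof (rule eventually_ball_finite[OF finite_I], rule ballI)
    fix i assume i: "i \<in> I"
    have "uniform_limit UNIV (\<lambda>k. h (p i) (bs k i)) (h (p i) (b i)) sequentially"
      by (rule member_uniform_limit[OF admissibleD[OF b i] admissibleD[OF bs i] lim[OF i]])
    then show "\<forall>\<^sub>F k in sequentially. \<forall>x\<in>UNIV. dist (h (p i) (bs k i) x) (h (p i) (b i) x) < e"
      using e by (auto simp: uniform_limit_iff)
  qed
  then show "\<forall>\<^sub>F k in sequentially. \<forall>x\<in>UNIV. dist (envelope (bs k) x) (envelope b x) < e"
  proof eventually_elim
    case (elim k)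
    show ?case
    proof
      fix x
      obtain i where i: "i \<in> I" "h (p i) (b i) x = envelope b x" by (rule envelope_attained)
      obtain j where j: "j \<in> I" "h (p j) (bs k j) x = envelope (bs k) x" by (rule envelope_attained)
      have "\<bar>h (p i) (bs k i) x - h (p i) (b i) x\<bar> < e" "\<bar>h (p j) (bs k j) x - h (p j) (b j) x\<bar> < e"
        using elim i(1) j(1) by (auto simp: dist_real_def)
      moreover have "h (p i) (bs k i) x \<le> envelope (bs k) x" "h (p j) (b j) x \<le> envelope b x"
        using i j by (auto intro: le_envelope)
      ultimately show "dist (envelope (bs k) x) (envelope b x) < e"
        using i j by (simp add: dist_real_def)
    qed
  qed
qed

text \<open>
  If \<open>p j\<close> is a value at \<open>x\<close> of the maps of infinitely many of the approximating envelopes, then it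
  is one for the limit envelope, by continuity of \<open>\<T>\<close> applied to a constant sequence of values.
  So the limit superior of the cells lies in the limit cell, and continuity from above of the
  finite measure \<open>\<omega>\<close> gives upper semicontinuity of the mass.
\<close>

lemma mass_usc:
  assumes b: "b \<in> admissible" and bs: "\<And>k. bs k \<in> admissible"
    and lim: "\<And>i. i \<in> I \<Longrightarrow> (\<lambda>k. bs k i) \<longlonglongrightarrow> b i" and e: "e > 0"
  shows "\<forall>\<^sub>F k in sequentially. mass (bs k) j < mass b j + e"
proof (rule ccontr)
  assume "\<not> ?thesis"
  then have "\<exists>\<^sub>F k in sequentially. mass b j + e \<le> mass (bs k) j"
    by (simp add: not_eventually not_less)
  then have "infinite {k. mass b j + e \<le> mass (bs k) j}"
    by (simp add: frequently_cofinite[symmetric] cofinite_eq_sequentially)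
  then obtain r :: "nat \<Rightarrow> nat" where r: "strict_mono r" "\<And>k. mass b j + e \<le> mass (bs (r k)) j"
    using infinite_enumerate by blast
  \<comment> \<open>The intersection of the tails \<open>B\<close> is the limit superior of the cells along \<open>r\<close>.\<close>
  define B where "B n = (\<Union>k\<in>{n..}. cell (bs (r k)) j)" for n
  have B_sets: "range B \<subseteq> sets \<omega>" using bs by (auto simp: B_def)
  have "decseq B" by (fastforce simp: B_def decseq_def)
  with B_sets have "(\<lambda>n. measure \<omega> (B n)) \<longlonglongrightarrow> measure \<omega> (\<Inter>n. B n)"
    by (rule finite_Lim_measure_decseq)
  moreover have "mass b j + e \<le> measure \<omega> (B n)" for n
  proof -
    have "mass (bs (r n)) j \<le> measure \<omega> (B n)"
      unfolding mass_def using B_sets by (intro finite_measure_mono) (auto simp: B_def)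
    then show ?thesis using r(2)[of n] by linarith
  qed
  ultimately have "mass b j + e \<le> measure \<omega> (\<Inter>n. B n)"
    by (intro LIMSEQ_le_const) auto
  also have "\<dots> \<le> mass b j"
    unfolding mass_def
  proof (rule finite_measure_mono[OF _ cell_sets[OF b]], rule subsetI)
    fix x assume "x \<in> (\<Inter>n. B n)"
    then have "\<forall>n. \<exists>k\<ge>n. x \<in> cell (bs (r k)) j" by (auto simp: B_def)
    then have "infinite {k. x \<in> cell (bs (r k)) j}"
      by (auto simp: infinite_nat_iff_unbounded_le)
    then obtain s :: "nat \<Rightarrow> nat" where s: "strict_mono s" "\<And>k. x \<in> cell (bs (r (s k))) j"
      using infinite_enumerate by blast
    have rs: "strict_mono (r \<circ> s)" using r(1) s(1) by (rule strict_mono_o)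
    have "uniform_limit UNIV (\<lambda>k. envelope (bs ((r \<circ> s) k))) (envelope b) sequentially"
      using b bs
    proof (rule envelope_uniform_limit)
      fix i assume "i \<in> I"
      from LIMSEQ_subseq_LIMSEQ[OF lim[OF this] rs]
      show "(\<lambda>k. bs ((r \<circ> s) k) i) \<longlonglongrightarrow> b i" by (simp add: o_def)
    qed
    moreover have "operator_cont_at \<F> \<T> (envelope b)"
      using convex envelope_in_\<F>[OF b] by (simp add: T_convex_def)
    moreover have "\<forall>k. envelope (bs ((r \<circ> s) k)) \<in> \<F>" using envelope_in_\<F>[OF bs] by simp
    moreover have "\<forall>k. p j \<in> \<T> (envelope (bs ((r \<circ> s) k))) x" using s(2) by (simp add: cell_def)
    ultimately obtain q y0 where
      "y0 \<in> \<T> (envelope b) x" "((\<lambda>_::nat. p j) \<circ> (q :: nat \<Rightarrow> nat)) \<longlonglongrightarrow> y0"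
      unfolding operator_cont_at_def
      by (elim allE[of _ "\<lambda>k. envelope (bs ((r \<circ> s) k))"] allE[of _ x] allE[of _ "\<lambda>_. p j"]) auto
    then show "x \<in> cell b j" by (simp add: cell_def o_def tendsto_const_iff)
  qed
  finally show False using e by simp
qed

text \<open>
  Since the masses have a constant sum, upper semicontinuity of all the other masses is lower
  semicontinuity of the given one.
\<close>

lemma mass_tendsto:
  assumes b: "b \<in> admissible" and bs: "\<And>k. bs k \<in> admissible"
    and lim: "\<And>i. i \<in> I \<Longrightarrow> (\<lambda>k. bs k i) \<longlonglongrightarrow> b i" and j: "j \<in> I"
  shows "(\<lambda>k. mass (bs k) j) \<longlonglongrightarrow> mass b j"
proof (rule LIMSEQ_I)
  fix e :: real assume e: "e > 0"
  \<comment> \<open>The error \<open>d\<close> is incurred once for each other index; the \<open>+ 1\<close> makes the total strictly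
    smaller than \<open>e\<close> and keeps \<open>d \<le> e\<close>.\<close>
  define d where "d = e / (card I + 1)"
  have d: "d > 0" using e by (simp add: d_def)
  have card_d: "card (I - {j}) * d < e" "d \<le> e"
  proof -
    have "card (I - {j}) * d \<le> card I * d" using d by (intro mult_right_mono) (auto intro: card_mono)
    also have "\<dots> < (card I + 1) * d" using d by simp
    finally show "card (I - {j}) * d < e" by (simp add: d_def)
    show "d \<le> e" using e by (simp add: d_def divide_le_eq)
  qed
  have "\<forall>\<^sub>F k in sequentially. \<forall>i\<in>I. mass (bs k) i < mass b i + d"
    using mass_usc[OF b bs lim d] by (intro eventually_ball_finite) auto
  then have "\<forall>\<^sub>F k in sequentially. norm (mass (bs k) j - mass b j) < e"
  proof eventually_elim
    case (elim k)
    have "(\<Sum>i\<in>I - {j}. mass (bs k) i) \<le> (\<Sum>i\<in>I - {j}. mass b i + d)"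
      using elim by (intro sum_mono) (auto intro: less_imp_le)
    then have "(\<Sum>i\<in>I - {j}. mass (bs k) i) < (\<Sum>i\<in>I - {j}. mass b i) + e"
      using card_d(1) by (simp add: sum.distrib)
    moreover have "mass (bs k) j + (\<Sum>i\<in>I - {j}. mass (bs k) i) = mass b j + (\<Sum>i\<in>I - {j}. mass b i)"
      using sum_mass[OF bs] sum_mass[OF b] j by (simp add: sum.remove[OF finite_I j, symmetric])
    moreover have "mass (bs k) j < mass b j + e" using elim j card_d(2) by force
    ultimately show ?case by simp
  qed
  then show "\<exists>no. \<forall>k\<ge>no. norm (mass (bs k) j - mass b j) < e"
    by (simp add: eventually_sequentially)
qed

lemma continuous_on_mass:
  assumes "S \<subseteq> admissible" "j \<in> I"
  shows "continuous_on S (\<lambda>b. mass b j)"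
proof (rule continuous_on_sequentiallyI)
  fix bs b assume bs: "\<forall>n. bs n \<in> S" "b \<in> S" "bs \<longlonglongrightarrow> b"
  have "(\<lambda>k. bs k i) \<longlonglongrightarrow> b i" for i
    using continuous_on_product_coordinates bs(3)
    by (rule continuous_on_tendsto_compose[where s = UNIV and f = "\<lambda>b. b i"]) auto
  then show "(\<lambda>k. mass (bs k) j) \<longlonglongrightarrow> mass b j"
    using bs assms by (intro mass_tendsto) auto
qed

section \<open>Prescribing the masses\<close>

lemma compact_box: "compact {b :: 'i \<Rightarrow> real. \<forall>i. b i \<in> {l i..u i}}"
proof -
  have "compactin (product_topology (\<lambda>_. euclidean) UNIV) (PiE UNIV (\<lambda>i::'i. {l i..u i}))"
    unfolding compactin_PiE by auto
  then show ?thesis by (simp add: euclidean_product_topology PiE_def Pi_def)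
qed

text \<open>
  A maximiser of the sum of parameters under the constraints \<open>mass b i \<le> g i\<close> for
  \<open>i \<noteq> i0\<close> satisfies all of them with equality. The base parameter stays fixed
  to keep the constraint set bounded: positive mass at \<open>i0\<close> prevents each other function from
  exceeding the fixed function of \<open>i0\<close> everywhere.
\<close>

lemma exists_prescribed_masses:
  assumes base: "i0 \<in> I" and g: "(\<Sum>i\<in>I. g i) = measure \<omega> UNIV" "g i0 > 0"
    and b0: "b0 \<in> admissible" and b0_le: "\<And>i. i \<in> I - {i0} \<Longrightarrow> mass b0 i \<le> g i"
  obtains b where "b \<in> admissible" "b i0 = b0 i0" "\<And>i. i \<in> I \<Longrightarrow> mass b i = g i"
proof -
  have base_mass: "mass b i0 + (\<Sum>i\<in>I - {i0}. mass b i) = g i0 + (\<Sum>i\<in>I - {i0}. g i)"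
    if "b \<in> admissible" for b
    using sum_mass[OF that] g(1) by (simp add: sum.remove[OF finite_I base, symmetric])
  obtain K where K: "\<And>x. \<bar>h (p i0) (b0 i0) x\<bar> \<le> K"
    using bounded_\<F>[OF member_in_\<F>[OF admissibleD[OF b0 base]]] by blast
  have "\<exists>t0. t0 \<in> open_interval (\<alpha> (p i)) (\<beta> (p i)) \<and>
      (\<forall>t x. t \<in> open_interval (\<alpha> (p i)) (\<beta> (p i)) \<longrightarrow> t0 < t \<longrightarrow> K + 1 \<le> h (p i) t x)" for i
    by (rule member_unbounded[of "p i" "K + 1"]) blast
  then obtain c where c: "\<And>i. c i \<in> open_interval (\<alpha> (p i)) (\<beta> (p i))"
    "\<And>i t x. t \<in> open_interval (\<alpha> (p i)) (\<beta> (p i)) \<Longrightarrow> c i < t \<Longrightarrow> K + 1 \<le> h (p i) t x"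
    by metis
  \<comment> \<open>Freezing the coordinates outside \<open>I - {i0}\<close> makes the box compact in the space of all
    functions on the index type.\<close>
  define u where "u i = (if i \<in> I - {i0} then c i else b0 i)" for i
  define Q where "Q = {b. \<forall>i. b i \<in> {b0 i..u i}}"
  define W where "W = Q \<inter> (\<Inter>i\<in>I - {i0}. {b \<in> Q. mass b i \<le> g i})"
  have Q_adm: "Q \<subseteq> admissible"
  proof
    fix b assume b: "b \<in> Q"
    have "b i \<in> open_interval (\<alpha> (p i)) (\<beta> (p i))" if "i \<in> I" for i
    proof -
      have b0_i: "b0 i \<in> open_interval (\<alpha> (p i)) (\<beta> (p i))" using b0 that by (rule admissibleD)
      then have u_i: "u i \<in> open_interval (\<alpha> (p i)) (\<beta> (p i))" using c(1) by (simp add: u_def)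
      have le: "ereal (b0 i) \<le> ereal (b i)" "ereal (b i) \<le> ereal (u i)"
        using b by (auto simp: Q_def)
      have "\<alpha> (p i) < ereal (b i)"
        using b0_i by (intro less_le_trans[OF _ le(1)]) (simp add: open_interval_def)
      moreover have "ereal (b i) < \<beta> (p i)"
        using u_i by (intro le_less_trans[OF le(2)]) (simp add: open_interval_def)
      ultimately show ?thesis by (simp add: open_interval_def)
    qed
    then show "b \<in> admissible" by (simp add: admissible_def)
  qed
  \<comment> \<open>Beyond \<open>c i\<close> the \<open>i\<close>-th function exceeds the base function everywhere, so no mass would be
    left for the base index.\<close>
  have bound: "b i \<le> c i"
    if b: "b \<in> admissible" "b i0 = b0 i0" "\<And>i. i \<in> I - {i0} \<Longrightarrow> mass b i \<le> g i"
      and i: "i \<in> I" for b i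
  proof (rule ccontr)
    assume "\<not> b i \<le> c i"
    then have "K + 1 \<le> h (p i) (b i) x" for x using c(2) admissibleD[OF b(1) i] by simp
    then have "h (p i0) (b i0) x < h (p i) (b i) x" for x
      using K[of x] b(2) by (smt (verit))
    then have "mass b i0 = 0" by (rule mass_eq_0_if_dominated[OF b(1) i base])
    moreover have "(\<Sum>i\<in>I - {i0}. mass b i) \<le> (\<Sum>i\<in>I - {i0}. g i)" using b(3) by (rule sum_mono)
    ultimately show False using base_mass[OF b(1)] g(2) by simp
  qed
  have W_I: "b \<in> W"
    if "b \<in> admissible" "b i0 = b0 i0" "\<And>i. b0 i \<le> b i" "\<And>i. i \<notin> I \<Longrightarrow> b i = b0 i"
      "\<And>i. i \<in> I - {i0} \<Longrightarrow> mass b i \<le> g i" for b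
  proof -
    have "b i \<le> u i" for i
      using bound[OF that(1,2,5), of i] that(2,4) by (auto simp: u_def)
    then show ?thesis using that by (auto simp: W_def Q_def)
  qed
  have Q_compact: "compact Q" unfolding Q_def by (rule compact_box)
  have "closed {b \<in> Q. mass b i \<le> g i}" if "i \<in> I - {i0}" for i
    using that
    by (intro continuous_on_closed_Collect_le continuous_on_mass[OF Q_adm] continuous_on_const
          compact_imp_closed[OF Q_compact]) auto
  then have "compact W" unfolding W_def by (intro compact_Int_closed[OF Q_compact]) auto
  moreover have "W \<noteq> {}" using W_I[OF b0] b0_le by auto
  moreover have "continuous_on W (\<lambda>b. \<Sum>i\<in>I. b i)"
    by (intro continuous_on_sum continuous_on_subset[OF continuous_on_product_coordinates subset_UNIV])
  ultimately have "\<exists>b\<in>W. \<forall>b'\<in>W. (\<Sum>i\<in>I. b' i) \<le> (\<Sum>i\<in>I. b i)"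
    by (rule continuous_attains_sup)
  then obtain b where b: "b \<in> W" and b_max: "\<And>b'. b' \<in> W \<Longrightarrow> (\<Sum>i\<in>I. b' i) \<le> (\<Sum>i\<in>I. b i)"
    by blast
  have bQ: "b0 i \<le> b i" "b i \<le> u i" for i using b by (auto simp: W_def Q_def)
  have b_adm: "b \<in> admissible" using b Q_adm by (auto simp: W_def)
  have b_le: "mass b i \<le> g i" if "i \<in> I - {i0}" for i using b that by (auto simp: W_def)
  have b_out: "b i = b0 i" if "i \<notin> I - {i0}" for i
    using bQ[of i] that by (auto simp: u_def)
  have eq: "mass b j = g j" if j: "j \<in> I - {i0}" for j
  proof (rule ccontr)
    assume "mass b j \<noteq> g j"
    with b_le[OF j] have less: "mass b j < g j" by simp
    have "b j \<in> open_interval (\<alpha> (p j)) (\<beta> (p j))" using b_adm j by (auto intro: admissibleD)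
    then have "ereal (b j) < \<beta> (p j)" by (simp add: open_interval_def)
    then obtain s where s: "ereal (b j) < ereal s" "ereal s < \<beta> (p j)"
      using ereal_dense2 by blast
    \<comment> \<open>Raise the \<open>j\<close>-th parameter by an amount tending to zero, staying in the open interval.\<close>
    define bs where "bs k = b(j := b j + (s - b j) / (k + 1))" for k :: nat
    have up: "b j < b j + (s - b j) / (k + 1)" "b j + (s - b j) / (k + 1) \<le> s" for k :: nat
    proof -
      show "b j < b j + (s - b j) / (k + 1)" using s(1) by simp
      have "(s - b j) / (k + 1) \<le> (s - b j) / 1" using s(1) by (intro divide_left_mono) auto
      then show "b j + (s - b j) / (k + 1) \<le> s" by simp
    qed
    have bs_adm: "bs k \<in> admissible" for k
    proof -
      have "bs k i \<in> open_interval (\<alpha> (p i)) (\<beta> (p i))" if "i \<in> I" for i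
      proof (cases "i = j")
        case True
        have "\<alpha> (p j) < ereal (b j)" using admissibleD[OF b_adm that] True by (simp add: open_interval_def)
        also have "\<dots> < ereal (bs k j)" using up(1)[of k] by (simp add: bs_def)
        finally have 1: "\<alpha> (p j) < ereal (bs k j)" .
        have "ereal (bs k j) \<le> ereal s" using up(2)[of k] by (simp add: bs_def)
        also note s(2)
        finally show ?thesis using 1 True by (simp add: open_interval_def)
      next
        case False
        then show ?thesis using admissibleD[OF b_adm that] by (simp add: bs_def)
      qed
      then show ?thesis by (simp add: admissible_def)
    qed
    have "(\<lambda>k. b j + (s - b j) / (real k + 1)) \<longlonglongrightarrow> b j + 0"
      using LIMSEQ_Suc[OF lim_const_over_n[of "s - b j"]]
      by (intro tendsto_add tendsto_const) (simp add: add.commute)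
    then have "(\<lambda>k. bs k i) \<longlonglongrightarrow> b i" for i by (cases "i = j") (simp_all add: bs_def add.commute)
    then have "(\<lambda>k. mass (bs k) j) \<longlonglongrightarrow> mass b j"
      using j by (intro mass_tendsto b_adm bs_adm) auto
    then have "\<forall>\<^sub>F k in sequentially. mass (bs k) j < g j" using less by (rule order_tendstoD)
    then obtain k where k: "mass (bs k) j < g j" by (auto simp: eventually_sequentially)
    have le: "b i \<le> bs k i" for i using up(1)[of k] by (auto simp: bs_def intro: less_imp_le)
    have "bs k \<in> W"
    proof (rule W_I[OF bs_adm])
      show "bs k i0 = b0 i0" using j b_out[of i0] by (auto simp: bs_def)
      show "b0 i \<le> bs k i" for i using bQ(1) le by (rule order_trans)
      show "bs k i = b0 i" if "i \<notin> I" for i using that j b_out[of i] by (auto simp: bs_def)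
      show "mass (bs k) i \<le> g i" if i: "i \<in> I - {i0}" for i
      proof (cases "i = j")
        case False
        then have "mass (bs k) i \<le> mass b i"
          using i le by (intro mass_antimono_others b_adm bs_adm) (auto simp: bs_def)
        also have "\<dots> \<le> g i" using i by (rule b_le)
        finally show ?thesis .
      qed (use k in simp)
    qed
    moreover have "(\<Sum>i\<in>I. b i) < (\<Sum>i\<in>I. bs k i)"
      using j up(1)[of k] le by (intro sum_strict_mono_ex1) (auto simp: bs_def)
    ultimately show False using b_max[of "bs k"] by simp
  qed
  have "mass b i0 = g i0" using base_mass[OF b_adm] eq by simp
  with eq have "mass b i = g i" if "i \<in> I" for i using that by (cases "i = i0") auto
  then show ?thesis using that b_adm b_out[of i0] by simp
qed

end

theorem theorem2p12:
  fixes \<omega> :: "'a::metric_space measure"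
    and N :: nat
    and p :: "nat \<Rightarrow> 'b::metric_space"
    and g :: "nat \<Rightarrow> real"
    and \<F> :: "('a \<Rightarrow> real) set"
    and \<T> :: "('a \<Rightarrow> real) \<Rightarrow> 'a \<Rightarrow> 'b set"
    and \<alpha> \<beta> :: "'b \<Rightarrow> ereal"
    and h :: "'b \<Rightarrow> real \<Rightarrow> 'a \<Rightarrow> real"
    and b0 :: "nat \<Rightarrow> real"
  assumes "compact (UNIV :: 'a set)"
    and "compact (UNIV :: 'b set)"
    and "radon_measure \<omega>"
    and "N \<ge> 2"
    and "inj_on p {1..N}"
    and "\<forall>i\<in>{1..N}. g i > 0"
    and "\<F> \<subseteq> cont_functions"
    and "\<T> \<in> \<F> \<rightarrow> surj_cont_set_maps \<omega>"
    and "T_convex \<omega> \<F> \<T>"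
    and "exhausting_families \<F> \<T> \<alpha> \<beta> h"
    and "measure \<omega> UNIV = (\<Sum>i=1..N. g i)"
    and "\<forall>i\<in>{1..N}. b0 i \<in> open_interval (\<alpha> (p i)) (\<beta> (p i))"
    and "\<forall>i\<in>{2..N}.
           measure (set_map_measure \<omega> (\<T> (\<lambda>x. MAX j\<in>{1..N}. h (p j) (b0 j) x))) {p i} \<le> g i"
  shows "\<exists>b :: nat \<Rightarrow> real.
           b 1 = b0 1 \<and>
           (\<forall>i\<in>{2..N}. b i \<in> open_interval (\<alpha> (p i)) (\<beta> (p i))) \<and>
           set_map_measure \<omega> (\<T> (\<lambda>x. MAX i\<in>{1..N}. h (p i) (b i) x)) = dirac_sum {1..N} g p"
proof -
  interpret E: finite_envelope \<omega> \<F> \<T> \<alpha> \<beta> h "{1..N}" p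
    using assms by unfold_locales auto
  have envelope: "E.envelope b = (\<lambda>x. MAX i\<in>{1..N}. h (p i) (b i) x)" for b
    by (rule ext, rule E.envelope_def)
  have b0: "b0 \<in> E.admissible" using assms(12) unfolding E.admissible_def by simp
  have mass_b0: "E.mass b0 i \<le> g i" if "i \<in> {1..N} - {1}" for i
  proof -
    have "i \<in> {2..N}" using that by auto
    with assms(13) show ?thesis
      unfolding E.mass_eq_set_map_measure[OF b0] envelope by (rule bspec)
  qed
  have base: "1 \<in> {1..N}" "0 < g 1" using assms(4,6) by auto
  obtain b where b: "b \<in> E.admissible" "b 1 = b0 1" "\<And>i. i \<in> {1..N} \<Longrightarrow> E.mass b i = g i"
    using E.exists_prescribed_masses[OF base(1) assms(11)[symmetric] base(2) b0 mass_b0] by metis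
  have "set_map_measure \<omega> (\<T> (E.envelope b)) = dirac_sum {1..N} (E.mass b) p"
    using b(1) by (rule E.set_map_measure_envelope)
  also have "\<dots> = dirac_sum {1..N} g p"
    unfolding dirac_sum_def
    by (intro arg_cong[where f = "measure_of UNIV (sets borel)"] ext sum.cong refl) (simp only: b(3))
  finally have "set_map_measure \<omega> (\<T> (\<lambda>x. MAX i\<in>{1..N}. h (p i) (b i) x)) = dirac_sum {1..N} g p"
    unfolding envelope .
  moreover have "\<forall>i\<in>{2..N}. b i \<in> open_interval (\<alpha> (p i)) (\<beta> (p i))"
    by (intro ballI E.admissibleD[OF b(1)]) auto
  ultimately show ?thesis using b(2) by blast
qed

end
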